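(* Let $p\in\mathbb{R}[x_1,\dots,x_n]$ be a homogeneous multiaffine polynomial of degree $k$ and let $P=\Phi(p)$ be its minor lift. If $p$ is stable, then $P$ is hyperbolic (with respect to the identity matrix) and $\mathrm{PSD}_k\subseteq H(P)$. In particular, $P$ is PSD-stable.
   Context: $\mathbb{R}^{n\times n}_{\mathrm{sym}}$ is the vector space of real symmetric $n\times n$ matrices and $X$ is a symmetric $n\times n$ matrix of indeterminates. For $J\subseteq[n]=\{1,\dots,n\}$, $X_J$ is the principal submatrix of $X$ with rows and columns in $J$ (with $\det X_\emptyset=1$). A polynomial is multiaffine if it is a linear combination of square-free monomials. For multiaffine $p=\sum_{J\subseteq[n]}a_J\prod_{i\in J}x_i$ the minor lift is $\Phi(p)(X)=\sum_{J\subseteq[n]}a_J\det(X_J)$, a polynomial on $\mathbb{R}^{n\times n}_{\mathrm{sym}}$. A polynomial $p\in\mathbb{R}[x_1,\dots,x_n]$ is stable if $p(z_1,\dots,z_n)\ne0$ whenever all $z_i\in\mathbb{C}$ have positive imaginary part. A polynomial $P$ on symmetric matrices is PSD-stable if it has no zero among complex symmetric matrices with positive definite imaginary part. A homogeneous polynomial $P$ on a real vector space $V$ is hyperbolic with respect to $a\in V$ if $P(a)\neq0$ and for every $v\in V$ the univariate polynomial $P(v-ta)$ in $t$ has only real roots; its hyperbolicity cone is the set of $v\in V$ such that all roots of $P(v-ta)$ are nonnegative. $H(P)$ denotes the hyperbolicity cone of $P$ with respect to the identity matrix. $\mathrm{PSD}_k$ is the set of $A\in\mathbb{R}^{n\times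 n}_{\mathrm{sym}}$ all of whose $k\times k$ principal submatrices are positive semidefinite. *)

theory Defs
  imports "HOL-Analysis.Analysis" "HOL-Library.Poly_Mapping"
begin

text \<open>
  Monomials in variables of type \<open>'v\<close> are exponent vectors \<open>'v \<Rightarrow>\<^sub>0 nat\<close>; the
  multiplication of the resulting ring is the convolution provided by the library.
  The index set \<open>[n]\<close> is a finite linearly ordered type.
\<close>

type_synonym ('v, 'a) mpoly = "('v \<Rightarrow>\<^sub>0 nat) \<Rightarrow>\<^sub>0 'a"

definition mpoly_const :: "'a \<Rightarrow> ('v, 'a::zero) mpoly" where
  "mpoly_const c = Poly_Mapping.single 0 c"

definition mpoly_var :: "'v \<Rightarrow> ('v, 'a::zero_neq_one) mpoly" where
  "mpoly_var v = Poly_Mapping.single (Poly_Mapping.single v 1) 1"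

definition mpoly_eval :: "('v \<Rightarrow> 'a::{comm_ring_1, real_algebra_1}) \<Rightarrow> ('v, real) mpoly \<Rightarrow> 'a" where
  "mpoly_eval f p =
    (\<Sum>m\<in>Poly_Mapping.keys p. of_real (Poly_Mapping.lookup p m) * (\<Prod>v\<in>Poly_Mapping.keys m. f v ^ Poly_Mapping.lookup m v))"

definition mpoly_homogeneous :: "nat \<Rightarrow> ('v, 'a::zero) mpoly \<Rightarrow> bool" where
  "mpoly_homogeneous d p \<longleftrightarrow> (\<forall>m\<in>Poly_Mapping.keys p. (\<Sum>v\<in>Poly_Mapping.keys m. Poly_Mapping.lookup m v) = d)"

definition multiaffine :: "('v, 'a::zero) mpoly \<Rightarrow> bool" where
  "multiaffine p \<longleftrightarrow> (\<forall>m\<in>Poly_Mapping.keys p. \<forall>v. Poly_Mapping.lookup m v \<le> 1)"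

definition squarefree_monom :: "'v set \<Rightarrow> ('v \<Rightarrow>\<^sub>0 nat)" where
  "squarefree_monom J = (\<Sum>i\<in>J. Poly_Mapping.single i 1)"

definition stable_mpoly :: "('v, real) mpoly \<Rightarrow> bool" where
  "stable_mpoly p \<longleftrightarrow> (\<forall>z :: 'v \<Rightarrow> complex. (\<forall>i. Im (z i) > 0) \<longrightarrow> mpoly_eval z p \<noteq> 0)"

definition sym_matrices :: "('a ^ 'n ^ 'n) set" where
  "sym_matrices = {A. transpose A = A}"

text \<open>
  The determinant of the principal submatrix with rows and columns in \<open>J\<close>: this is
  the library's definition of \<^const>\<open>det\<close> with \<open>J\<close> in place of the whole index type.
\<close>

definition principal_minor :: "'n set \<Rightarrow> 'a::comm_ring_1 ^ 'n ^ 'n \<Rightarrow> 'a" where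
  "principal_minor J A =
    (\<Sum>\<pi> | \<pi> permutes J. of_int (sign \<pi>) * (\<Prod>i\<in>J. A $ i $ \<pi> i))"

lemma principal_minor_UNIV: "principal_minor UNIV A = det A"
  by (simp add: principal_minor_def det_def)

lemma principal_minor_empty: "principal_minor {} A = 1"
  by (simp add: principal_minor_def sign_id)

text \<open>
  A polynomial on symmetric matrices is a polynomial in the indeterminates
  \<open>x\<^sub>i\<^sub>j\<close> with \<open>i \<le> j\<close>, indexed by the pairs \<open>(i, j)\<close>. Variables \<open>(i, j)\<close> with
  \<open>i > j\<close> do not occur in \<open>sym_indet\<close>.
\<close>

definition sym_indet :: "('n \<times> 'n, real) mpoly ^ ('n::{finite,linorder}) ^ ('n::{finite,linorder})" where
  "sym_indet = (\<chi> i j. mpoly_var (min i j, max i j))"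

definition matrix_eval ::
    "('n::finite \<times> 'n, real) mpoly \<Rightarrow> 'a::{comm_ring_1, real_algebra_1} ^ 'n ^ 'n \<Rightarrow> 'a" where
  "matrix_eval P A = mpoly_eval (\<lambda>(i, j). A $ i $ j) P"

definition minor_lift ::
    "('n::{finite,linorder}, real) mpoly \<Rightarrow> ('n \<times> 'n, real) mpoly" where
  "minor_lift p =
    (\<Sum>J\<in>UNIV. mpoly_const (Poly_Mapping.lookup p (squarefree_monom J)) * principal_minor J sym_indet)"

definition pos_def :: "real ^ 'n ^ 'n \<Rightarrow> bool" where
  "pos_def A \<longleftrightarrow> A \<in> sym_matrices \<and> (\<forall>x. x \<noteq> 0 \<longrightarrow> x \<bullet> (A *v x) > 0)"

definition PSD_stable :: "('n::finite \<times> 'n, real) mpoly \<Rightarrow> bool" where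
  "PSD_stable P \<longleftrightarrow>
    (\<forall>Z :: complex ^ 'n ^ 'n. Z \<in> sym_matrices \<and> pos_def (\<chi> i j. Im (Z $ i $ j))
       \<longrightarrow> matrix_eval P Z \<noteq> 0)"

text \<open>
  The complex roots of the univariate real polynomial \<open>P(v - t a)\<close> in \<open>t\<close>; the
  ambient real vector space is that of the symmetric matrices.
\<close>

definition line_roots ::
    "('n::finite \<times> 'n, real) mpoly \<Rightarrow> real ^ 'n ^ 'n \<Rightarrow> real ^ 'n ^ 'n \<Rightarrow> complex set" where
  "line_roots P a v =
    {t. matrix_eval P (\<chi> i j. of_real (v $ i $ j) - t * of_real (a $ i $ j)) = 0}"

definition hyperbolic :: "('n::finite \<times> 'n, real) mpoly \<Rightarrow> real ^ 'n ^ 'n \<Rightarrow> bool" where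
  "hyperbolic P a \<longleftrightarrow>
    (\<exists>d. mpoly_homogeneous d P) \<and> a \<in> sym_matrices \<and> matrix_eval P a \<noteq> 0 \<and>
    (\<forall>v\<in>sym_matrices. line_roots P a v \<subseteq> \<real>)"

definition hyperbolicity_cone ::
    "('n::finite \<times> 'n, real) mpoly \<Rightarrow> real ^ 'n ^ 'n \<Rightarrow> (real ^ 'n ^ 'n) set" where
  "hyperbolicity_cone P a =
    {v \<in> sym_matrices. \<forall>t\<in>line_roots P a v. t \<in> \<real>\<^sub>\<ge>\<^sub>0}"

text \<open>The quadratic form below is that of the principal submatrix with index set \<open>J\<close>.\<close>

definition PSD_minors :: "nat \<Rightarrow> (real ^ 'n ^ 'n::finite) set" where
  "PSD_minors k =
    {A \<in> sym_matrices. \<forall>J. card J = k \<longrightarrow>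
       (\<forall>x :: 'n \<Rightarrow> real. (\<Sum>i\<in>J. \<Sum>j\<in>J. x i * A $ i $ j * x j) \<ge> 0)}"

end

theory Submission
  imports Defs
begin

text \<open>
  Let \<open>a\<^sub>J\<close> be the coefficients of \<open>p\<close>. On symmetric matrices the minor lift is
  \<open>P(Z) = \<Sum>\<^sub>J a\<^sub>J det Z\<^sub>J\<close>.

  PSD-stability comes first. The principal minors of \<open>Z\<close> are the coefficients of the multiaffine
  polynomial \<open>det (diag s + diag w Z) = \<Sum>\<^sub>J w\<^sup>J s\<^bsup>-J\<^esup> det Z\<^sub>J\<close> (\<open>det_diagonal_plus_row_scaled\<close>), homogeneous
  in each pair \<open>(s\<^sub>i, w\<^sub>i)\<close>, so \<open>P(Z)\<close> is the pairing of this polynomial with \<open>p\<close>. If \<open>Im Z \<ge> \<epsilon> I\<close>, the determinant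
  has no zero with all \<open>s\<^sub>i / w\<^sub>i\<close> infinite or of imaginary part at least \<open>- \<delta>\<close>, where \<open>\<delta> < \<epsilon>\<close>
  (\<open>det_line_cone_nz\<close>). Starting from the product \<open>p(z) det (diag s + diag w Z)\<close>, which has no zero for
  \<open>z\<close> in the upper half plane and such \<open>(s, w)\<close>, the variables \<open>z\<^sub>i\<close> and \<open>(s\<^sub>i, w\<^sub>i)\<close> are contracted
  against each other, one index after the other. A single contraction preserves nonvanishing
  (\<open>contract_pair\<close>), an argument in the spirit of the Lieb-Sokal lemma; after all of them
  (\<open>contract_all_pairs\<close>) the number \<open>P(Z)\<close> is left, so it is nonzero.

  Hyperbolicity is a consequence: for nonreal \<open>t\<close> the matrix \<open>v - t I\<close> or its complex conjugate has
  positive definite imaginary part, and \<open>P\<close> has real coefficients.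

  For the cone, a homogeneous stable polynomial has coefficients of one sign
  (\<open>stable_coeffs_same_sign\<close>), supported on sets of size \<open>k\<close>. If \<open>v \<in> PSD\<^sub>k\<close> and \<open>r < 0\<close>, the minors of size \<open>k\<close>
  of \<open>v - r I\<close> are positive (\<open>principal_minor_pos\<close>). Hence \<open>P(v - r I)\<close> is a sum of terms of one sign that
  are not all zero, and \<open>r\<close> is not a root.
\<close>

section \<open>Evaluation of polynomials and of minor lifts\<close>

text \<open>
  With a common summation set and a product over all variables, evaluations of different
  polynomials can be compared termwise.
\<close>

lemma mpoly_eval_superset:
  fixes f :: "'v::finite \<Rightarrow> 'a::{comm_ring_1, real_algebra_1}"
  assumes "finite K" "Poly_Mapping.keys p \<subseteq> K"
  shows "mpoly_eval f p =
    (\<Sum>m\<in>K. of_real (Poly_Mapping.lookup p m) * (\<Prod>v\<in>UNIV. f v ^ Poly_Mapping.lookup m v))"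
proof -
  have "(\<Prod>v\<in>Poly_Mapping.keys m. f v ^ Poly_Mapping.lookup m v)
      = (\<Prod>v\<in>UNIV. f v ^ Poly_Mapping.lookup m v)" for m
    by (rule prod.mono_neutral_left) (auto simp: in_keys_iff)
  then show ?thesis
    unfolding mpoly_eval_def using assms
    by (simp, intro sum.mono_neutral_left) (auto simp: in_keys_iff)
qed

lemma mpoly_eval_zero: "mpoly_eval f 0 = 0"
  by (simp add: mpoly_eval_def)

lemma mpoly_eval_single:
  fixes f :: "'v::finite \<Rightarrow> 'a::{comm_ring_1, real_algebra_1}"
  shows "mpoly_eval f (Poly_Mapping.single m c) = of_real c * (\<Prod>v\<in>UNIV. f v ^ Poly_Mapping.lookup m v)"
  by (subst mpoly_eval_superset[where K = "{m}"]) auto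

lemma mpoly_eval_add:
  fixes f :: "'v::finite \<Rightarrow> 'a::{comm_ring_1, real_algebra_1}"
  shows "mpoly_eval f (p + q) = mpoly_eval f p + mpoly_eval f q"
  by (simp add: mpoly_eval_superset[where K = "Poly_Mapping.keys p \<union> Poly_Mapping.keys q"]
      keys_add lookup_add distrib_right sum.distrib)

lemma mpoly_eval_sum:
  fixes f :: "'v::finite \<Rightarrow> 'a::{comm_ring_1, real_algebra_1}"
  shows "mpoly_eval f (\<Sum>x\<in>A. g x) = (\<Sum>x\<in>A. mpoly_eval f (g x))"
  by (induction A rule: infinite_finite_induct) (auto simp: mpoly_eval_zero mpoly_eval_add)

lemma poly_mapping_eq_sum_single:
  "p = (\<Sum>m\<in>Poly_Mapping.keys p. Poly_Mapping.single m (Poly_Mapping.lookup p m))"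
  by (rule poly_mapping_eqI)
     (auto simp: lookup_sum lookup_single when_def sum.delta in_keys_iff)

lemma mpoly_eval_mult:
  fixes f :: "'v::finite \<Rightarrow> 'a::{comm_ring_1, real_algebra_1}"
  shows "mpoly_eval f (p * q) = mpoly_eval f p * mpoly_eval f q"
proof -
  have "mpoly_eval f (p * q) = mpoly_eval f
      ((\<Sum>m\<in>Poly_Mapping.keys p. Poly_Mapping.single m (Poly_Mapping.lookup p m)) *
       (\<Sum>m\<in>Poly_Mapping.keys q. Poly_Mapping.single m (Poly_Mapping.lookup q m)))"
    using poly_mapping_eq_sum_single[of p] poly_mapping_eq_sum_single[of q] by simp
  also have "\<dots> = mpoly_eval f (\<Sum>m\<in>Poly_Mapping.keys p. Poly_Mapping.single m (Poly_Mapping.lookup p m)) *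
       mpoly_eval f (\<Sum>m\<in>Poly_Mapping.keys q. Poly_Mapping.single m (Poly_Mapping.lookup q m))"
    unfolding sum_product mpoly_eval_sum
    by (simp add: mult_single mpoly_eval_single lookup_add power_add prod.distrib mult_ac)
  also have "\<dots> = mpoly_eval f p * mpoly_eval f q"
    using poly_mapping_eq_sum_single[of p] poly_mapping_eq_sum_single[of q] by simp
  finally show ?thesis .
qed

lemma mpoly_eval_of_int:
  fixes f :: "'v::finite \<Rightarrow> 'a::{comm_ring_1, real_algebra_1}"
  shows "mpoly_eval f (of_int c) = of_int c"
  unfolding single_of_int[symmetric] by (simp add: mpoly_eval_single del: single_of_int)

lemma mpoly_eval_const:
  fixes f :: "'v::finite \<Rightarrow> 'a::{comm_ring_1, real_algebra_1}"
  shows "mpoly_eval f (mpoly_const c) = of_real c"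
  by (simp add: mpoly_const_def mpoly_eval_single)

lemma mpoly_eval_var:
  fixes f :: "'v::finite \<Rightarrow> 'a::{comm_ring_1, real_algebra_1}"
  shows "mpoly_eval f (mpoly_var v) = f v"
proof -
  have "(\<Prod>u\<in>UNIV. f u ^ Poly_Mapping.lookup (Poly_Mapping.single v (1::nat)) u)
      = (\<Prod>u\<in>UNIV. if u = v then f u else 1)"
    by (intro prod.cong) (auto simp: lookup_single when_def)
  then show ?thesis
    by (simp add: mpoly_var_def mpoly_eval_single)
qed

lemma mpoly_eval_prod:
  fixes f :: "'v::finite \<Rightarrow> 'a::{comm_ring_1, real_algebra_1}"
  shows "mpoly_eval f (\<Prod>x\<in>A. g x) = (\<Prod>x\<in>A. mpoly_eval f (g x))"
  using mpoly_eval_of_int[of f 1]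
  by (induction A rule: infinite_finite_induct) (auto simp: mpoly_eval_mult)

abbreviation minor_coeff :: "('n::finite, real) mpoly \<Rightarrow> 'n set \<Rightarrow> real" where
  "minor_coeff p J \<equiv> Poly_Mapping.lookup p (squarefree_monom J)"

text \<open>
  The indeterminates only cover entries on or above the diagonal; symmetry of \<open>Z\<close> is what turns
  the entry at \<open>(min i j, max i j)\<close> into the entry at \<open>(i, j)\<close>.
\<close>

lemma matrix_eval_minor_lift:
  fixes Z :: "'a::{comm_ring_1, real_algebra_1} ^ ('n::{finite,linorder}) ^ ('n::{finite,linorder})"
  assumes "Z \<in> sym_matrices"
  shows "matrix_eval (minor_lift p) Z =
    (\<Sum>J\<in>UNIV. of_real (minor_coeff p J) * principal_minor J Z)"
proof -
  have sym: "Z $ i $ j = Z $ j $ i" for i j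
    using assms by (auto simp: sym_matrices_def transpose_def vec_eq_iff)
  have "Z $ min i j $ max i j = Z $ i $ j" for i j
    using sym[of i j] by (auto simp: min_def max_def)
  then show ?thesis
    by (simp add: matrix_eval_def minor_lift_def mpoly_eval_sum mpoly_eval_mult mpoly_eval_const
        principal_minor_def mpoly_eval_prod mpoly_eval_of_int sym_indet_def mpoly_eval_var)
qed

lemma lookup_squarefree_monom:
  "Poly_Mapping.lookup (squarefree_monom J) (v::'v::finite) = (if v \<in> J then 1 else 0)"
  by (simp add: squarefree_monom_def lookup_sum lookup_single when_def)

lemma inj_squarefree_monom: "inj (squarefree_monom :: 'v::finite set \<Rightarrow> _)"
proof (rule injI, rule set_eqI)
  fix I J :: "'v set" and v
  assume "squarefree_monom I = squarefree_monom J"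
  then have "Poly_Mapping.lookup (squarefree_monom I) v = Poly_Mapping.lookup (squarefree_monom J) v"
    by simp
  then show "v \<in> I \<longleftrightarrow> v \<in> J"
    by (simp add: lookup_squarefree_monom split: if_splits)
qed

lemma mpoly_eval_multiaffine:
  fixes f :: "'v::finite \<Rightarrow> 'a::{comm_ring_1, real_algebra_1}"
  assumes "multiaffine p"
  shows "mpoly_eval f p = (\<Sum>J\<in>UNIV. of_real (minor_coeff p J) * (\<Prod>i\<in>J. f i))"
proof -
  have "m \<in> range squarefree_monom" if "m \<in> Poly_Mapping.keys p" for m
  proof -
    have "Poly_Mapping.lookup m v \<le> 1" for v
      using assms that by (auto simp: multiaffine_def)
    then have "m = squarefree_monom {v. Poly_Mapping.lookup m v = 1}"
      by (intro poly_mapping_eqI) (auto simp: lookup_squarefree_monom le_Suc_eq)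
    then show ?thesis by blast
  qed
  then have "mpoly_eval f p = (\<Sum>m\<in>range squarefree_monom. of_real (Poly_Mapping.lookup p m) *
      (\<Prod>v\<in>UNIV. f v ^ Poly_Mapping.lookup m v))"
    by (intro mpoly_eval_superset) auto
  also have "\<dots> = (\<Sum>J\<in>UNIV. of_real (minor_coeff p J) *
      (\<Prod>v\<in>UNIV. if v \<in> J then f v else 1))"
    by (simp add: sum.reindex[OF inj_squarefree_monom] lookup_squarefree_monom
        if_distrib[of "\<lambda>n. _ ^ n"] cong: if_cong)
  finally show ?thesis
    by (simp add: prod.If_cases)
qed

section \<open>Homogeneity\<close>

lemma mpoly_homogeneous_zero: "mpoly_homogeneous d 0"
  by (simp add: mpoly_homogeneous_def)

lemma mpoly_homogeneous_add:
  assumes "mpoly_homogeneous d p" "mpoly_homogeneous d q"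
  shows "mpoly_homogeneous d (p + q)"
  using assms keys_add[of p q] unfolding mpoly_homogeneous_def by blast

lemma mpoly_homogeneous_sum:
  assumes "\<And>x. x \<in> A \<Longrightarrow> mpoly_homogeneous d (g x)"
  shows "mpoly_homogeneous d (\<Sum>x\<in>A. g x)"
  using assms by (induction A rule: infinite_finite_induct)
    (auto simp: mpoly_homogeneous_zero mpoly_homogeneous_add)

lemma mpoly_homogeneous_mult:
  assumes "mpoly_homogeneous d p" "mpoly_homogeneous e q"
  shows "mpoly_homogeneous (d + e) (p * q)"
  unfolding mpoly_homogeneous_def
proof
  fix m assume "m \<in> Poly_Mapping.keys (p * q)"
  then obtain a b where m: "m = a + b" "a \<in> Poly_Mapping.keys p" "b \<in> Poly_Mapping.keys q"
    using keys_mult[of p q] by blast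
  have "(\<Sum>v\<in>Poly_Mapping.keys m. Poly_Mapping.lookup m v)
      = (\<Sum>v\<in>Poly_Mapping.keys a. Poly_Mapping.lookup a v) + (\<Sum>v\<in>Poly_Mapping.keys b. Poly_Mapping.lookup b v)"
    unfolding m(1) by (rule setsum_keys_plus_distrib) auto
  with m assms show "(\<Sum>v\<in>Poly_Mapping.keys m. Poly_Mapping.lookup m v) = d + e"
    by (simp add: mpoly_homogeneous_def)
qed

lemma mpoly_homogeneous_const: "mpoly_homogeneous 0 (mpoly_const c)"
  by (simp add: mpoly_homogeneous_def mpoly_const_def)

lemma mpoly_homogeneous_of_int: "mpoly_homogeneous 0 (of_int c)"
  unfolding single_of_int[symmetric] by (simp add: mpoly_homogeneous_def del: single_of_int)

lemma mpoly_homogeneous_var: "mpoly_homogeneous 1 (mpoly_var v)"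
  by (simp add: mpoly_homogeneous_def mpoly_var_def)

lemma mpoly_homogeneous_prod:
  fixes g :: "'a \<Rightarrow> ('v, real) mpoly"
  assumes "finite A" "\<And>x. x \<in> A \<Longrightarrow> mpoly_homogeneous 1 (g x)"
  shows "mpoly_homogeneous (card A) (\<Prod>x\<in>A. g x)"
  using assms
proof (induction A rule: finite_induct)
  case empty
  show ?case using mpoly_homogeneous_of_int[of 1, where 'b = real and 'a = 'v] by simp
next
  case (insert x A)
  then show ?case using mpoly_homogeneous_mult[of 1 "g x" "card A" "\<Prod>x\<in>A. g x"] by simp
qed

lemma mpoly_homogeneous_principal_minor:
  "mpoly_homogeneous (card J) (principal_minor J (sym_indet :: _ ^ ('n::{finite,linorder}) ^ ('n::{finite,linorder})))"
  unfolding principal_minor_def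
proof (rule mpoly_homogeneous_sum)
  fix \<pi> :: "'n \<Rightarrow> 'n"
  have "mpoly_homogeneous (card J) (\<Prod>i\<in>J. sym_indet $ i $ \<pi> i)"
    by (rule mpoly_homogeneous_prod) (auto simp: sym_indet_def intro: mpoly_homogeneous_var[unfolded One_nat_def])
  from mpoly_homogeneous_mult[OF mpoly_homogeneous_of_int this]
  show "mpoly_homogeneous (card J) (of_int (sign \<pi>) * (\<Prod>i\<in>J. sym_indet $ i $ \<pi> i))"
    by simp
qed

lemma minor_coeff_homogeneous:
  assumes "mpoly_homogeneous k p" "minor_coeff p J \<noteq> 0"
  shows "card (J::'v::finite set) = k"
proof -
  have "(\<Sum>v\<in>Poly_Mapping.keys (squarefree_monom J). Poly_Mapping.lookup (squarefree_monom J) v) = k"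
    using assms by (auto simp: mpoly_homogeneous_def in_keys_iff)
  moreover have "Poly_Mapping.keys (squarefree_monom J) = J"
    by (auto simp: in_keys_iff lookup_squarefree_monom split: if_splits)
  ultimately show ?thesis by (simp add: lookup_squarefree_monom)
qed

lemma mpoly_homogeneous_minor_lift:
  assumes "mpoly_homogeneous k p"
  shows "mpoly_homogeneous k (minor_lift p)"
  unfolding minor_lift_def
proof (rule mpoly_homogeneous_sum)
  fix J :: "'a set"
  show "mpoly_homogeneous k (mpoly_const (minor_coeff p J) * principal_minor J sym_indet)"
  proof (cases "minor_coeff p J = 0")
    case True
    then show ?thesis by (simp add: mpoly_const_def mpoly_homogeneous_zero)
  next
    case False
    from mpoly_homogeneous_mult[OF mpoly_homogeneous_const mpoly_homogeneous_principal_minor]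
    show ?thesis using minor_coeff_homogeneous[OF assms False] by auto
  qed
qed

section \<open>Contracting pairs of variables\<close>

lemma quadratic_nonneg_leading:
  fixes a b c :: real
  assumes "\<And>t. t > 0 \<Longrightarrow> a * t\<^sup>2 + b * t + c \<ge> 0"
  shows "a \<ge> 0"
proof (rule ccontr)
  assume "\<not> a \<ge> 0"
  \<comment> \<open>Large enough for \<open>a t\<^sup>2\<close> to outweigh the two lower terms.\<close>
  define t where "t = (\<bar>b\<bar> + \<bar>c\<bar>) / (-a) + 1"
  have t1: "t \<ge> 1" using \<open>\<not> a \<ge> 0\<close> by (simp add: t_def divide_nonneg_neg)
  have "a * t = a - (\<bar>b\<bar> + \<bar>c\<bar>)"
    using \<open>\<not> a \<ge> 0\<close> by (simp add: t_def field_simps)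
  then have "a * t\<^sup>2 = a * t - (\<bar>b\<bar> + \<bar>c\<bar>) * t"
    by (simp add: power2_eq_square mult.assoc[symmetric] left_diff_distrib)
  moreover have "b * t \<le> \<bar>b\<bar> * t" "c \<le> \<bar>c\<bar> * t" "a * t < 0"
    using t1 \<open>\<not> a \<ge> 0\<close> mult_left_mono[of 1 t "\<bar>c\<bar>"] by (auto intro: mult_right_mono mult_neg_pos)
  ultimately have "a * t\<^sup>2 + b * t + c < 0" by (simp add: algebra_simps)
  with assms[of t] t1 show False by linarith
qed

text \<open>
  The pairing of two multiaffine polynomials that sums the products of equally indexed
  coefficients is computed one variable at a time: each step contracts a polynomial in a pair
  \<open>z\<close>, \<open>w\<close> of variables to the sum of its coefficients of \<open>1\<close> and of \<open>z w\<close>. Nonvanishing has to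
  survive such a step, and this depends on the region allowed for \<open>w\<close>.

  The cone consists of homogeneous coordinates for that region of the Riemann sphere. For \<open>w \<noteq> 0\<close> the inequality says that
  \<open>s / w\<close> has imaginary part at least \<open>- \<delta>\<close>; the pairs with \<open>w = 0\<close> are the point at infinity. Both the
  point at infinity and a margin \<open>\<delta> > 0\<close> matter for the contraction of \<open>f = a\<^sub>0\<^sub>0 s + a\<^sub>1\<^sub>0 z s + a\<^sub>0\<^sub>1 w +
  a\<^sub>1\<^sub>1 z w\<close> to \<open>a\<^sub>0\<^sub>0 + a\<^sub>1\<^sub>1\<close>: without infinity \<open>f = w\<close>, and for \<open>\<delta> = 0\<close> also \<open>f = z s - w\<close>, would have no
  zero with \<open>z\<close> in the upper half plane, yet both contract to zero.
\<close>

definition line_cone :: "real \<Rightarrow> (complex \<times> complex) set" where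
  "line_cone \<delta> = {(s, w). (s, w) \<noteq> (0, 0) \<and> Im (cnj s * w) \<le> \<delta> * (cmod w)\<^sup>2}"

text \<open>
  If \<open>a\<^sub>1\<^sub>1 = - a\<^sub>0\<^sub>0\<close>, then \<open>f = A z * s + B z * w\<close> with \<open>A z = a\<^sub>0\<^sub>0 + a\<^sub>1\<^sub>0 z\<close> and \<open>B z = a\<^sub>0\<^sub>1 - a\<^sub>0\<^sub>0 z\<close>, so for
  each \<open>z\<close> in the upper half plane the zero \<open>(B z, - A z)\<close> lies outside the cone; in particular
  \<open>A z \<noteq> 0\<close>. Letting \<open>z = i t\<close> tend to infinity gives \<open>Im (cnj a\<^sub>0\<^sub>0 * a\<^sub>1\<^sub>0) \<ge> \<delta> \<bar>a\<^sub>1\<^sub>0\<bar>\<^sup>2\<close>. If \<open>a\<^sub>1\<^sub>0 \<noteq> 0\<close>, this puts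
  the root \<open>- a\<^sub>0\<^sub>0 / a\<^sub>1\<^sub>0\<close> of \<open>A\<close> into the open upper half plane, a contradiction. If \<open>a\<^sub>1\<^sub>0 = 0\<close>, the next
  term \<open>- \<bar>a\<^sub>0\<^sub>0\<bar>\<^sup>2 Im z\<close> decides.
\<close>

lemma contract_pair:
  fixes a00 a10 a01 a11 :: complex
  assumes "\<delta> > 0"
    and nz: "\<And>z s w. Im z > 0 \<Longrightarrow> (s, w) \<in> line_cone \<delta> \<Longrightarrow>
      a00 * s + a10 * z * s + a01 * w + a11 * z * w \<noteq> 0"
  shows "a00 + a11 \<noteq> 0"
proof
  assume "a00 + a11 = 0"
  then have a11: "a11 = - a00" by (simp add: add_eq_0_iff)
  define A where "A z = a00 + a10 * z" for z
  define B where "B z = a01 - a00 * z" for z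
  have key: "A z \<noteq> 0 \<and> - Im (cnj (B z) * A z) > \<delta> * (cmod (A z))\<^sup>2" if z: "Im z > 0" for z
  proof -
    have "a00 * B z + a10 * z * B z + a01 * (- A z) + a11 * z * (- A z) = 0"
      by (simp add: A_def B_def a11 algebra_simps)
    then have "(B z, - A z) \<notin> line_cone \<delta>" using nz[OF z] by blast
    moreover have "(1, 0) \<in> line_cone \<delta>" "(0, 1) \<in> line_cone \<delta>"
      using assms(1) by (auto simp: line_cone_def)
    then have "A z \<noteq> 0 \<or> B z \<noteq> 0"
      using nz[OF z, of 0 1] by (auto simp: A_def B_def a11 algebra_simps)
    ultimately have *: "- Im (cnj (B z) * A z) > \<delta> * (cmod (A z))\<^sup>2"
      by (auto simp: line_cone_def)
    then show ?thesis by (cases "A z = 0") auto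
  qed
  have "Im (cnj a00 * a10) - \<delta> * (cmod a10)\<^sup>2 \<ge> 0"
  proof (rule quadratic_nonneg_leading)
    fix t :: real assume t: "t > 0"
    have "- Im (cnj (B (Complex 0 t)) * A (Complex 0 t)) - \<delta> * (cmod (A (Complex 0 t)))\<^sup>2
      = (Im (cnj a00 * a10) - \<delta> * (cmod a10)\<^sup>2) * t\<^sup>2
        + (- (cmod a00)\<^sup>2 - Re (cnj a01 * a10) - 2 * \<delta> * (Im a00 * Re a10 - Re a00 * Im a10)) * t
        + (- Im (cnj a01 * a00) - \<delta> * (cmod a00)\<^sup>2)"
      unfolding cmod_power2 A_def B_def by (simp add: algebra_simps power2_eq_square)
    with key[of "Complex 0 t"] t
    show "(Im (cnj a00 * a10) - \<delta> * (cmod a10)\<^sup>2) * t\<^sup>2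
        + (- (cmod a00)\<^sup>2 - Re (cnj a01 * a10) - 2 * \<delta> * (Im a00 * Re a10 - Re a00 * Im a10)) * t
        + (- Im (cnj a01 * a00) - \<delta> * (cmod a00)\<^sup>2) \<ge> 0" by simp
  qed
  then have lead: "Im (cnj a00 * a10) \<ge> \<delta> * (cmod a10)\<^sup>2" by simp
  show False
  proof (cases "a10 = 0")
    case False
    then have "Im (cnj a00 * a10) > 0"
      using lead assms(1) by (smt (verit) mult_pos_pos zero_less_norm_iff zero_less_power)
    moreover have "Im (- a00 / a10) = Im (cnj a00 * a10) / (cmod a10)\<^sup>2"
      unfolding Im_divide cmod_power2
      by (simp add: algebra_simps minus_divide_left del: divide_minus_left)
    ultimately have "Im (- a00 / a10) > 0" using False by simp
    from key[OF this] show False using False by (simp add: A_def)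
  next
    case True
    have "a00 \<noteq> 0" using key[of \<i>] True by (simp add: A_def)
    (* Here the decisive term is linear in the imaginary part of z, so z = i t^2 makes it quadratic. *)
    have "- ((cmod a00)\<^sup>2) \<ge> 0"
    proof (rule quadratic_nonneg_leading)
      fix t :: real assume t: "t > 0"
      have "0 \<le> \<delta> * (cmod a00)\<^sup>2" using assms(1) by simp
      moreover have "- Im (cnj (B (Complex 0 (t\<^sup>2))) * A (Complex 0 (t\<^sup>2)))
          = - ((cmod a00)\<^sup>2) * t\<^sup>2 + 0 * t - Im (cnj a01 * a00)"
        unfolding cmod_power2 A_def B_def True by (simp add: algebra_simps power2_eq_square)
      ultimately show "- ((cmod a00)\<^sup>2) * t\<^sup>2 + 0 * t + (- Im (cnj a01 * a00)) \<ge> 0"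
        using key[of "Complex 0 (t\<^sup>2)"] t True by (simp add: A_def)
    qed
    with \<open>a00 \<noteq> 0\<close> show False by simp
  qed
qed

lemma sum_Pow_insert:
  assumes "finite S" "x \<notin> S"
  shows "(\<Sum>J\<in>Pow (insert x S). f J) = (\<Sum>J\<in>Pow S. f J) + (\<Sum>J\<in>Pow S. f (insert x J))"
proof -
  have "inj_on (insert x) (Pow S)"
    using assms(2) by (auto simp: inj_on_def)
  then show ?thesis
    unfolding Pow_insert using assms
    by (subst sum.union_disjoint) (auto simp: sum.reindex)
qed

text \<open>
  A nonvanishing principle of Lieb-Sokal type. The hypothesis concerns an arbitrary coefficient
  array \<open>c\<close> and not a product of two polynomials, because after the first contraction the two
  groups of variables no longer separate.
\<close>

lemma contract_all_pairs:
  fixes c :: "'n set \<Rightarrow> 'n set \<Rightarrow> complex"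
  assumes "finite S" "\<delta> > 0"
    and "\<And>z s w. (\<forall>i\<in>S. Im (z i) > 0) \<Longrightarrow> (\<forall>i\<in>S. (s i, w i) \<in> line_cone \<delta>) \<Longrightarrow>
      (\<Sum>I\<in>Pow S. \<Sum>J\<in>Pow S. c I J * (\<Prod>i\<in>I. z i) * ((\<Prod>i\<in>J. w i) * (\<Prod>i\<in>S-J. s i))) \<noteq> 0"
  shows "(\<Sum>J\<in>Pow S. c J J) \<noteq> 0"
  using assms(1,3)
proof (induction S arbitrary: c rule: finite_induct)
  case empty
  then show ?case by simp
next
  case (insert x S)
  define c' where "c' I J = c I J + c (insert x I) (insert x J)" for I J
  have "(\<Sum>J\<in>Pow S. c' J J) \<noteq> 0"
  proof (rule insert.IH[of c'])
    fix z s w :: "'n \<Rightarrow> complex"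
    assume z: "\<forall>i\<in>S. Im (z i) > 0" and sw: "\<forall>i\<in>S. (s i, w i) \<in> line_cone \<delta>"
    \<comment> \<open>The coefficients \<open>c\<close> are split by membership of \<open>x\<close> in \<open>I\<close> and in \<open>J\<close>; evaluated at the
      other variables, the four parts are the numbers to which the one-pair case applies.\<close>
    define T where "T d = (\<Sum>I\<in>Pow S. \<Sum>J\<in>Pow S.
        d I J * (\<Prod>i\<in>I. z i) * ((\<Prod>i\<in>J. w i) * (\<Prod>i\<in>S-J. s i)))" for d
    have "T c + T (\<lambda>I J. c (insert x I) (insert x J)) \<noteq> 0"
    proof (rule contract_pair[OF assms(2)])
      fix zx sx wx assume zx: "Im zx > 0" and swx: "(sx, wx) \<in> line_cone \<delta>"
      let ?z = "z(x := zx)" and ?s = "s(x := sx)" and ?w = "w(x := wx)"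
      have nx: "x \<notin> I" if "I \<subseteq> S" for I using that insert.hyps by auto
      have upd: "prod (f(x := y)) I = prod f I" if "x \<notin> I" for f y and I :: "'n set"
        using that by (intro prod.cong) auto
      have ins: "prod (f(x := y)) (insert x I) = y * prod f I" if "I \<subseteq> S" for f y I
        using that insert.hyps finite_subset[OF that] nx[OF that]
        by (simp add: upd del: fun_upd_apply) simp
      have diff: "insert x S - I = insert x (S - I)" "insert x S - insert x I = S - I"
        if "I \<subseteq> S" for I using nx[OF that] insert.hyps by auto
      have out: "x \<notin> S - I" for I using insert.hyps by auto
      have "(\<Sum>I\<in>Pow (insert x S). \<Sum>J\<in>Pow (insert x S).
          c I J * prod ?z I * (prod ?w J * prod ?s (insert x S - J)))
        = T c * sx + T (\<lambda>I J. c (insert x I) J) * zx * sx + T (\<lambda>I J. c I (insert x J)) * wx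
          + T (\<lambda>I J. c (insert x I) (insert x J)) * zx * wx"
        unfolding sum_Pow_insert[OF insert.hyps(1,2)] sum.distrib T_def sum_distrib_right
        by (auto simp: sum.distrib[symmetric] upd ins diff nx out algebra_simps simp del: fun_upd_apply
              intro!: sum.cong)
      moreover have "(\<Sum>I\<in>Pow (insert x S). \<Sum>J\<in>Pow (insert x S).
          c I J * prod ?z I * (prod ?w J * prod ?s (insert x S - J))) \<noteq> 0"
        by (rule insert.prems) (use z sw zx swx in auto)
      ultimately show "T c * sx + T (\<lambda>I J. c (insert x I) J) * zx * sx + T (\<lambda>I J. c I (insert x J)) * wx
          + T (\<lambda>I J. c (insert x I) (insert x J)) * zx * wx \<noteq> 0" by simp
    qed
    also have "T c + T (\<lambda>I J. c (insert x I) (insert x J)) = T c'"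
      by (simp add: T_def c'_def sum.distrib distrib_right)
    finally show "(\<Sum>I\<in>Pow S. \<Sum>J\<in>Pow S.
        c' I J * (\<Prod>i\<in>I. z i) * ((\<Prod>i\<in>J. w i) * (\<Prod>i\<in>S-J. s i))) \<noteq> 0"
      by (simp add: T_def)
  qed
  then show ?case
    by (simp add: sum_Pow_insert[OF insert.hyps(1,2)] c'_def sum.distrib)
qed

section \<open>Mixed determinants\<close>

text \<open>
  Choosing in each row either the diagonal term or the scaled row leaves, for a given set \<open>J\<close> of
  scaled rows, exactly the permutations that fix every index outside \<open>J\<close>. Thus the principal minors
  are the coefficients of a polynomial whose zeros can be studied through the kernel of a matrix.
\<close>

lemma det_diagonal_plus_row_scaled:
  fixes Z :: "'a::comm_ring_1 ^ 'n ^ 'n"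
  shows "det (\<chi> i j. (if i = j then s i else 0) + w i * Z $ i $ j)
    = (\<Sum>J\<in>UNIV. ((\<Prod>i\<in>J. w i) * (\<Prod>i\<in>UNIV-J. s i)) * principal_minor J Z)"
proof -
  have "det (\<chi> i j. (if i = j then s i else 0) + w i * Z $ i $ j)
    = (\<Sum>\<pi> | \<pi> permutes UNIV. of_int (sign \<pi>) *
        (\<Prod>i\<in>UNIV. w i * Z $ i $ \<pi> i + (if i = \<pi> i then s i else 0)))"
    by (simp add: det_def add.commute)
  also have "\<dots> = (\<Sum>\<pi> | \<pi> permutes UNIV. \<Sum>J\<in>UNIV. of_int (sign \<pi>) *
        ((\<Prod>i\<in>J. w i * Z $ i $ \<pi> i) * (\<Prod>i\<in>UNIV-J. if i = \<pi> i then s i else 0)))"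
    by (simp add: prod_add sum_distrib_left)
  also have "\<dots> = (\<Sum>J\<in>UNIV. \<Sum>\<pi> | \<pi> permutes UNIV. of_int (sign \<pi>) *
        ((\<Prod>i\<in>J. w i * Z $ i $ \<pi> i) * (\<Prod>i\<in>UNIV-J. if i = \<pi> i then s i else 0)))"
    by (rule sum.swap)
  also have "\<dots> = (\<Sum>J\<in>UNIV. ((\<Prod>i\<in>J. w i) * (\<Prod>i\<in>UNIV-J. s i)) * principal_minor J Z)"
  proof (rule sum.cong[OF refl])
    fix J :: "'n set"
    have "(\<Sum>\<pi> | \<pi> permutes UNIV. of_int (sign \<pi>) *
        ((\<Prod>i\<in>J. w i * Z $ i $ \<pi> i) * (\<Prod>i\<in>UNIV-J. if i = \<pi> i then s i else 0)))
      = (\<Sum>\<pi> | \<pi> permutes J. of_int (sign \<pi>) *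
        ((\<Prod>i\<in>J. w i * Z $ i $ \<pi> i) * (\<Prod>i\<in>UNIV-J. if i = \<pi> i then s i else 0)))"
    proof (rule sum.mono_neutral_right)
      show "\<forall>\<pi>\<in>{\<pi>. \<pi> permutes UNIV} - {\<pi>. \<pi> permutes J}. of_int (sign \<pi>) *
        ((\<Prod>i\<in>J. w i * Z $ i $ \<pi> i) * (\<Prod>i\<in>UNIV-J. if i = \<pi> i then s i else 0)) = 0"
      proof
        fix \<pi> assume \<pi>: "\<pi> \<in> {\<pi>. \<pi> permutes UNIV} - {\<pi>. \<pi> permutes J}"
        then obtain i where "i \<in> UNIV - J" "\<pi> i \<noteq> i"
          using permutes_superset[of \<pi> UNIV J] by auto
        then have "(\<Prod>i\<in>UNIV-J. if i = \<pi> i then s i else 0) = 0"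
          by (intro prod_zero bexI[of _ i]) auto
        then show "of_int (sign \<pi>) *
          ((\<Prod>i\<in>J. w i * Z $ i $ \<pi> i) * (\<Prod>i\<in>UNIV-J. if i = \<pi> i then s i else 0)) = 0" by simp
      qed
    qed (auto intro: permutes_subset)
    also have "\<dots> = (\<Sum>\<pi> | \<pi> permutes J. ((\<Prod>i\<in>J. w i) * (\<Prod>i\<in>UNIV-J. s i)) *
        (of_int (sign \<pi>) * (\<Prod>i\<in>J. Z $ i $ \<pi> i)))"
    proof (rule sum.cong[OF refl])
      fix \<pi> assume "\<pi> \<in> {\<pi>. \<pi> permutes J}"
      then have "(\<Prod>i\<in>UNIV-J. if i = \<pi> i then s i else 0) = (\<Prod>i\<in>UNIV-J. s i)"
        by (intro prod.cong) (auto simp: permutes_not_in)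
      then show "of_int (sign \<pi>) *
        ((\<Prod>i\<in>J. w i * Z $ i $ \<pi> i) * (\<Prod>i\<in>UNIV-J. if i = \<pi> i then s i else 0))
        = ((\<Prod>i\<in>J. w i) * (\<Prod>i\<in>UNIV-J. s i)) * (of_int (sign \<pi>) * (\<Prod>i\<in>J. Z $ i $ \<pi> i))"
        by (simp add: prod.distrib mult_ac)
    qed
    finally show "(\<Sum>\<pi> | \<pi> permutes UNIV. of_int (sign \<pi>) *
        ((\<Prod>i\<in>J. w i * Z $ i $ \<pi> i) * (\<Prod>i\<in>UNIV-J. if i = \<pi> i then s i else 0)))
      = ((\<Prod>i\<in>J. w i) * (\<Prod>i\<in>UNIV-J. s i)) * principal_minor J Z"
      by (simp add: principal_minor_def sum_distrib_left)
  qed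
  finally show ?thesis .
qed

text \<open>
  Minors of any size become determinants over the full index type, to which the criterion by
  kernels applies.
\<close>

lemma principal_minor_eq_det:
  fixes Z :: "'a::comm_ring_1 ^ 'n ^ 'n"
  shows "principal_minor J Z = det (\<chi> i j. if i \<in> J then Z $ i $ j else mat 1 $ i $ j)"
proof -
  \<comment> \<open>With these indicator weights only the term of \<open>J\<close> survives in the expansion above.\<close>
  define w s :: "'n \<Rightarrow> 'a" where "w i = (if i \<in> J then 1 else 0)" and "s i = (if i \<in> J then 0 else 1)" for i
  have "prod w I * prod s (UNIV - I) = (if I = J then 1 else 0)" for I
  proof (cases "I = J")
    case True
    then show ?thesis by (auto simp: w_def s_def intro!: prod.neutral)
  next
    case False
    then have "prod w I = 0 \<or> prod s (UNIV - I) = 0"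
      by (cases "I \<subseteq> J") (auto simp: w_def s_def intro!: prod_zero)
    then show ?thesis using False by auto
  qed
  then have "principal_minor J Z = det (\<chi> i j. (if i = j then s i else 0) + w i * Z $ i $ j)"
    unfolding det_diagonal_plus_row_scaled by (simp add: if_distrib[of "\<lambda>x. x * _"] cong: if_cong)
  also have "(\<chi> i j. (if i = j then s i else 0) + w i * Z $ i $ j)
      = (\<chi> i j. if i \<in> J then Z $ i $ j else mat 1 $ i $ j)"
    by (auto simp: vec_eq_iff w_def s_def mat_def)
  finally show ?thesis .
qed

lemma principal_minor_mat_1: "principal_minor J (mat 1 :: 'a::comm_ring_1 ^ 'n ^ 'n) = 1"
proof -
  have "(\<chi> i j. if i \<in> J then mat 1 $ i $ j else mat 1 $ i $ j) = (mat 1 :: 'a ^ 'n ^ 'n)"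
    by (simp add: vec_eq_iff)
  then show ?thesis by (simp add: principal_minor_eq_det)
qed

lemma principal_minor_of_real:
  "principal_minor J (\<chi> i j. complex_of_real (A $ i $ j)) = of_real (principal_minor J A)"
  by (simp add: principal_minor_def)

lemma principal_minor_cnj:
  "principal_minor J (\<chi> i j. cnj (Z $ i $ j)) = cnj (principal_minor J Z)"
  by (simp add: principal_minor_def)

lemma det_nz_if_kernel_trivial:
  fixes A :: "'a::field ^ 'n ^ 'n"
  assumes "\<And>v. A *v v = 0 \<Longrightarrow> v = 0"
  shows "det A \<noteq> 0"
  using assms matrix_left_invertible_ker[of A] invertible_left_inverse[of A] invertible_det_nz[of A]
  by blast

text \<open>By compactness of the unit sphere.\<close>

lemma pos_def_coercive:
  fixes B :: "real ^ 'n ^ 'n"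
  assumes "pos_def B"
  obtains \<epsilon> where "\<epsilon> > 0" "\<And>x. x \<bullet> (B *v x) \<ge> \<epsilon> * (norm x)\<^sup>2"
proof -
  have "continuous_on (sphere 0 1) (\<lambda>x. x \<bullet> (B *v x))"
    by (intro continuous_on_inner continuous_on_id linear_continuous_on
        matrix_vector_mul_bounded_linear)
  moreover have "sphere (0::real ^ 'n) 1 \<noteq> {}" by simp
  ultimately obtain x0 where x0: "x0 \<in> sphere 0 1"
      "\<And>y. y \<in> sphere 0 1 \<Longrightarrow> x0 \<bullet> (B *v x0) \<le> y \<bullet> (B *v y)"
    using continuous_attains_inf[OF compact_sphere] by blast
  show thesis
  proof (rule that)
    have "x0 \<noteq> 0" using x0(1) by auto
    then show "x0 \<bullet> (B *v x0) > 0"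
      using assms by (simp add: pos_def_def)
    fix x :: "real ^ 'n"
    show "x0 \<bullet> (B *v x0) * (norm x)\<^sup>2 \<le> x \<bullet> (B *v x)"
    proof (cases "x = 0")
      case False
      define y where "y = inverse (norm x) *\<^sub>R x"
      have xy: "x = norm x *\<^sub>R y" and "y \<in> sphere 0 1"
        using False by (auto simp: y_def)
      then have "x0 \<bullet> (B *v x0) \<le> y \<bullet> (B *v y)" using x0(2) by blast
      moreover have "x \<bullet> (B *v x) = (norm x)\<^sup>2 * (y \<bullet> (B *v y))"
        using arg_cong[OF xy, of "\<lambda>u. u \<bullet> (B *v u)"]
        by (simp add: matrix_vector_mult_scaleR power2_eq_square mult.assoc)
      ultimately show ?thesis
        by (simp add: mult.commute[of "(norm x)\<^sup>2"] mult_right_mono)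
    qed simp
  qed
qed

text \<open>
  The cross terms between real and imaginary part of \<open>v\<close> involve only \<open>Re Z\<close> and cancel because
  \<open>Z\<close> is symmetric.
\<close>

lemma Im_hermitian_form:
  fixes Z :: "complex ^ 'n ^ 'n" and v :: "complex ^ 'n"
  assumes "Z \<in> sym_matrices"
  defines "x \<equiv> (\<chi> i. Re (v $ i))" and "y \<equiv> (\<chi> i. Im (v $ i))" and "B \<equiv> (\<chi> i j. Im (Z $ i $ j))"
  shows "Im (\<Sum>i\<in>UNIV. cnj (v $ i) * (Z *v v) $ i) = x \<bullet> (B *v x) + y \<bullet> (B *v y)"
proof -
  have sym: "Z $ i $ j = Z $ j $ i" for i j
    using assms(1) by (auto simp: sym_matrices_def transpose_def vec_eq_iff)
  have "Im (\<Sum>i\<in>UNIV. cnj (v $ i) * (Z *v v) $ i)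
      = (\<Sum>i\<in>UNIV. \<Sum>j\<in>UNIV. Im (cnj (v $ i) * (Z $ i $ j * v $ j)))"
    by (simp add: matrix_vector_mult_def sum_distrib_left)
  also have "\<dots> = (\<Sum>i\<in>UNIV. \<Sum>j\<in>UNIV. x $ i * (B $ i $ j * x $ j)) + (\<Sum>i\<in>UNIV. \<Sum>j\<in>UNIV. y $ i * (B $ i $ j * y $ j))
      + ((\<Sum>i\<in>UNIV. \<Sum>j\<in>UNIV. x $ i * Re (Z $ i $ j) * y $ j) - (\<Sum>i\<in>UNIV. \<Sum>j\<in>UNIV. y $ i * Re (Z $ i $ j) * x $ j))"
    unfolding sum.distrib[symmetric] sum_subtractf[symmetric]
    by (intro sum.cong refl) (simp add: x_def y_def B_def algebra_simps)
  also have "(\<Sum>i\<in>UNIV. \<Sum>j\<in>UNIV. x $ i * Re (Z $ i $ j) * y $ j) = (\<Sum>i\<in>UNIV. \<Sum>j\<in>UNIV. y $ i * Re (Z $ i $ j) * x $ j)"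
    by (subst sum.swap) (simp add: sym mult_ac)
  finally show ?thesis
    by (simp add: inner_vec_def matrix_vector_mult_def sum_distrib_left)
qed

text \<open>
  A kernel vector \<open>v\<close> satisfies \<open>s\<^sub>i v\<^sub>i + w\<^sub>i (Z v)\<^sub>i = 0\<close>, so \<open>(v\<^sub>i, (Z v)\<^sub>i)\<close> is proportional to
  \<open>(w\<^sub>i, - s\<^sub>i)\<close> and the cone condition bounds \<open>Im (cnj v\<^sub>i * (Z v)\<^sub>i)\<close> by \<open>\<delta> \<bar>v\<^sub>i\<bar>\<^sup>2\<close>. Summed over \<open>i\<close> this
  contradicts the lower bound by \<open>\<epsilon>\<close> unless \<open>v = 0\<close>.
\<close>

lemma det_line_cone_nz:
  fixes Z :: "complex ^ 'n ^ 'n"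
  assumes Z: "Z \<in> sym_matrices"
    and coercive: "\<And>x. x \<bullet> ((\<chi> i j. Im (Z $ i $ j)) *v x) \<ge> \<epsilon> * (norm x)\<^sup>2"
    and "\<delta> < \<epsilon>"
    and cone: "\<And>i. (s i, w i) \<in> line_cone \<delta>"
  shows "det (\<chi> i j. (if i = j then s i else 0) + w i * Z $ i $ j) \<noteq> 0"
proof (rule det_nz_if_kernel_trivial)
  fix v assume v: "(\<chi> i j. (if i = j then s i else 0) + w i * Z $ i $ j) *v v = 0"
  define u where "u = Z *v v"
  define x y where "x = (\<chi> i. Re (v $ i))" and "y = (\<chi> i. Im (v $ i))"
  have row: "s i * v $ i + w i * u $ i = 0" for i
  proof -
    have "((\<chi> i j. (if i = j then s i else 0) + w i * Z $ i $ j) *v v) $ i = 0" by (simp add: v)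
    then show ?thesis
      by (simp add: matrix_vector_mult_def u_def distrib_right sum.distrib sum_distrib_left
          if_distrib[of "\<lambda>x. x * _"] mult.assoc cong: if_cong)
  qed
  have norms: "(\<Sum>i\<in>UNIV. (cmod (v $ i))\<^sup>2) = (norm x)\<^sup>2 + (norm y)\<^sup>2"
    by (simp add: x_def y_def norm_vec_def L2_set_def sum_nonneg cmod_power2 sum.distrib)
  have "Im (cnj (v $ i) * u $ i) \<le> \<delta> * (cmod (v $ i))\<^sup>2" for i
  proof (cases "w i = 0")
    case True
    then have "v $ i = 0" using row[of i] cone[of i] by (auto simp: line_cone_def)
    then show ?thesis by simp
  next
    case False
    define \<kappa> where "\<kappa> = v $ i / w i"
    have \<kappa>: "v $ i = \<kappa> * w i" "u $ i = - (\<kappa> * s i)"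
      using False row[of i] by (auto simp: \<kappa>_def field_simps add_eq_0_iff2)
    have "cnj (v $ i) * u $ i = - ((cnj \<kappa> * \<kappa>) * (cnj (w i) * s i))"
      by (simp add: \<kappa>)
    also have "cnj \<kappa> * \<kappa> = complex_of_real ((cmod \<kappa>)\<^sup>2)"
      by (metis complex_norm_square mult.commute)
    finally have "Im (cnj (v $ i) * u $ i) = (cmod \<kappa>)\<^sup>2 * Im (cnj (s i) * w i)"
      by (simp add: algebra_simps)
    also have "\<dots> \<le> (cmod \<kappa>)\<^sup>2 * (\<delta> * (cmod (w i))\<^sup>2)"
      using cone[of i] by (intro mult_left_mono) (auto simp: line_cone_def)
    also have "\<dots> = \<delta> * (cmod (v $ i))\<^sup>2"
      by (simp add: \<kappa> norm_mult power_mult_distrib)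
    finally show ?thesis .
  qed
  then have "Im (\<Sum>i\<in>UNIV. cnj (v $ i) * u $ i) \<le> \<delta> * ((norm x)\<^sup>2 + (norm y)\<^sup>2)"
    unfolding norms[symmetric] sum_distrib_left Im_sum by (intro sum_mono)
  moreover have "Im (\<Sum>i\<in>UNIV. cnj (v $ i) * u $ i) \<ge> \<epsilon> * ((norm x)\<^sup>2 + (norm y)\<^sup>2)"
    unfolding u_def Im_hermitian_form[OF Z] using coercive[of x] coercive[of y]
    by (simp add: x_def y_def distrib_left)
  ultimately have "(\<epsilon> - \<delta>) * ((norm x)\<^sup>2 + (norm y)\<^sup>2) \<le> 0"
    by (simp add: left_diff_distrib)
  moreover have "(norm x)\<^sup>2 + (norm y)\<^sup>2 \<ge> 0" by simp
  ultimately have "(norm x)\<^sup>2 + (norm y)\<^sup>2 = 0"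
    using \<open>\<delta> < \<epsilon>\<close> by (smt (verit) mult_pos_pos)
  then have "x = 0" "y = 0" by (auto simp: sum_power2_eq_zero_iff)
  then show "v = 0"
    by (auto simp: x_def y_def vec_eq_iff complex_eq_iff)
qed

text \<open>
  The value of the minor lift at \<open>Z\<close> is the full contraction of the product of \<open>p\<close> with the mixed
  determinant of \<open>Z\<close>. Neither factor vanishes: the first by stability, the second because the
  imaginary part of \<open>Z\<close> exceeds the margin of the cone.
\<close>

theorem PSD_stable_minor_lift:
  fixes p :: "('n::{finite,linorder}, real) mpoly"
  assumes "multiaffine p" "stable_mpoly p"
  shows "PSD_stable (minor_lift p)"
  unfolding PSD_stable_def
proof (intro allI impI, elim conjE)
  fix Z :: "((complex, 'n) vec, 'n) vec"
  assume Z: "Z \<in> sym_matrices" and "pos_def (\<chi> i j. Im (Z $ i $ j))"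
  then obtain \<epsilon> where \<epsilon>: "\<epsilon> > 0" "\<And>x. x \<bullet> ((\<chi> i j. Im (Z $ i $ j)) *v x) \<ge> \<epsilon> * (norm x)\<^sup>2"
    using pos_def_coercive by blast
  have "(\<Sum>J\<in>Pow UNIV. of_real (minor_coeff p J) * principal_minor J Z) \<noteq> 0"
  proof (rule contract_all_pairs[where \<delta> = "\<epsilon> / 2"
        and c = "\<lambda>I J. of_real (minor_coeff p I) * principal_minor J Z"])
    fix z s w :: "'n \<Rightarrow> complex"
    assume z: "\<forall>i\<in>UNIV. Im (z i) > 0" and sw: "\<forall>i\<in>UNIV. (s i, w i) \<in> line_cone (\<epsilon> / 2)"
    have "mpoly_eval z p \<noteq> 0"
      using assms(2) z by (simp add: stable_mpoly_def)
    moreover have "det (\<chi> i j. (if i = j then s i else 0) + w i * Z $ i $ j) \<noteq> 0"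
      using \<epsilon>(1) sw by (intro det_line_cone_nz[OF Z \<epsilon>(2), of "\<epsilon> / 2"]) auto
    ultimately have "mpoly_eval z p * det (\<chi> i j. (if i = j then s i else 0) + w i * Z $ i $ j) \<noteq> 0"
      by simp
    also have "mpoly_eval z p * det (\<chi> i j. (if i = j then s i else 0) + w i * Z $ i $ j)
      = (\<Sum>I\<in>Pow UNIV. \<Sum>J\<in>Pow UNIV. of_real (minor_coeff p I) * principal_minor J Z * prod z I *
          (prod w J * prod s (UNIV - J)))"
      unfolding mpoly_eval_multiaffine[OF assms(1)] det_diagonal_plus_row_scaled sum_product
      by (simp add: mult_ac)
    finally show "(\<Sum>I\<in>Pow UNIV. \<Sum>J\<in>Pow UNIV. of_real (minor_coeff p I) * principal_minor J Z *
        prod z I * (prod w J * prod s (UNIV - J))) \<noteq> 0" .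
  qed (use \<epsilon>(1) in auto)
  then show "matrix_eval (minor_lift p) Z \<noteq> 0"
    by (simp add: matrix_eval_minor_lift[OF Z])
qed

section \<open>Signs of coefficients and of minors\<close>

text \<open>By homogeneity \<open>p (i x) = i\<^sup>k p x\<close>, and \<open>i x\<close> has positive imaginary parts.\<close>

lemma stable_nz_on_positive_orthant:
  fixes p :: "('n::finite, real) mpoly"
  assumes "multiaffine p" "mpoly_homogeneous k p" "stable_mpoly p"
    and "\<And>i. x i > 0"
  shows "(\<Sum>J\<in>UNIV. minor_coeff p J * (\<Prod>i\<in>J. x i)) \<noteq> 0"
proof -
  have "of_real (minor_coeff p J) * (\<Prod>i\<in>J. \<i> * of_real (x i))
      = \<i> ^ k * of_real (minor_coeff p J * (\<Prod>i\<in>J. x i))" for J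
    using minor_coeff_homogeneous[OF assms(2), of J]
    by (cases "minor_coeff p J = 0") (auto simp: prod.distrib)
  then have "mpoly_eval (\<lambda>i. \<i> * of_real (x i)) p
      = \<i> ^ k * of_real (\<Sum>J\<in>UNIV. minor_coeff p J * (\<Prod>i\<in>J. x i))"
    by (simp only: mpoly_eval_multiaffine[OF assms(1)] sum_distrib_left of_real_sum)
  moreover have "mpoly_eval (\<lambda>i. \<i> * of_real (x i)) p \<noteq> 0"
    using assms(3,4) by (simp add: stable_mpoly_def)
  ultimately show ?thesis by (metis mult_zero_right of_real_0)
qed

text \<open>
  Let the coefficient of \<open>J\<close> be nonzero, and set the variables in \<open>J\<close> to one and the others to \<open>t\<close>. At \<open>t = 0\<close> only the sets \<open>I \<subseteq> J\<close> contribute, and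
  as all monomials have the same degree only \<open>J\<close> itself remains; at \<open>t = 1\<close> the value is the sum of
  all coefficients. There is no zero in between, so the two values have the same sign.
\<close>

lemma stable_coeffs_same_sign:
  fixes p :: "('n::finite, real) mpoly"
  assumes "multiaffine p" "mpoly_homogeneous k p" "stable_mpoly p"
  shows "(\<Sum>I\<in>UNIV. minor_coeff p I) * minor_coeff p J \<ge> 0"
proof (cases "minor_coeff p J = 0")
  case False
  define e where "e = (\<Sum>I\<in>UNIV. minor_coeff p I)"
  define g where "g t = (\<Sum>I\<in>UNIV. minor_coeff p I * (\<Prod>i\<in>I. t ^ (if i \<in> J then 0 else 1)))" for t
  have nz: "g t \<noteq> 0" if "t > 0" for t
    unfolding g_def using that by (intro stable_nz_on_positive_orthant[OF assms]) auto
  have g1: "g 1 = e" by (simp add: g_def e_def)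
  have "minor_coeff p I * (\<Prod>i\<in>I. (0::real) ^ (if i \<in> J then 0 else 1)) = (if I = J then minor_coeff p J else 0)" for I
  proof (cases "I \<subseteq> J \<and> minor_coeff p I \<noteq> 0")
    case True
    then have "I = J"
      using minor_coeff_homogeneous[OF assms(2)] False by (metis card_subset_eq finite)
    then show ?thesis by simp
  next
    case I: False
    then have "minor_coeff p I = 0 \<or> (\<Prod>i\<in>I. (0::real) ^ (if i \<in> J then 0 else 1)) = 0"
      by (auto intro!: prod_zero)
    then show ?thesis using I False by auto
  qed
  then have g0: "g 0 = minor_coeff p J" by (simp add: g_def)
  have cont: "continuous_on {0..1} (\<lambda>t. e * g t)"
    unfolding g_def by (intro continuous_intros)
  show ?thesis
  proof (rule ccontr)
    assume "\<not> ?thesis"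
    then have "e * g 0 < 0" "e * g 1 > 0"
      by (auto simp: g0 g1 e_def[symmetric] zero_less_mult_iff not_le mult_less_0_iff)
    then obtain t where "0 \<le> t" "t \<le> 1" "e * g t = 0"
      using IVT'[of "\<lambda>t. e * g t" 0 0 1] cont by auto
    with \<open>e * g 0 < 0\<close> nz[of t] show False by (cases "t = 0") auto
  qed
qed simp

lemma principal_minor_nz:
  fixes M :: "real ^ 'n ^ 'n"
  assumes pos: "\<And>x. \<exists>i\<in>J. x i \<noteq> 0 \<Longrightarrow> (\<Sum>i\<in>J. \<Sum>j\<in>J. x i * M $ i $ j * x j) > 0"
  shows "principal_minor J M \<noteq> 0"
  unfolding principal_minor_eq_det
proof (rule det_nz_if_kernel_trivial)
  fix v :: "real ^ 'n"
  let ?M = "\<chi> i j. if i \<in> J then M $ i $ j else mat 1 $ i $ j"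
  assume v: "?M *v v = 0"
  have off: "v $ i = 0" if "i \<notin> J" for i
  proof -
    have "(?M *v v) $ i = v $ i"
      using that by (simp add: matrix_vector_mult_def mat_def if_distrib[of "\<lambda>x. x * _"] cong: if_cong)
    then show ?thesis using v by simp
  qed
  have on: "(\<Sum>j\<in>J. M $ i $ j * v $ j) = 0" if "i \<in> J" for i
  proof -
    have "(?M *v v) $ i = (\<Sum>j\<in>UNIV. M $ i $ j * v $ j)"
      using that by (simp add: matrix_vector_mult_def)
    also have "\<dots> = (\<Sum>j\<in>J. M $ i $ j * v $ j)"
      by (intro sum.mono_neutral_right) (auto simp: off)
    finally show ?thesis using v by simp
  qed
  have "(\<Sum>i\<in>J. \<Sum>j\<in>J. v $ i * M $ i $ j * v $ j) = (\<Sum>i\<in>J. v $ i * (\<Sum>j\<in>J. M $ i $ j * v $ j))"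
    by (simp add: sum_distrib_left mult.assoc)
  also have "\<dots> = 0" by (simp add: on)
  finally have "\<forall>i\<in>J. v $ i = 0" using pos[of "\<lambda>i. v $ i"] by force
  with off show "v = 0" by (metis vec_eq_iff zero_index)
qed

lemma sum_mat_1_quadratic:
  fixes x :: "'n::finite \<Rightarrow> real"
  shows "(\<Sum>i\<in>J. \<Sum>j\<in>J. x i * (mat 1 :: real ^ 'n ^ 'n) $ i $ j * x j) = (\<Sum>i\<in>J. (x i)\<^sup>2)"
  by (simp add: mat_def power2_eq_square if_distrib[of "\<lambda>y. _ * y"] if_distrib[of "\<lambda>y. y * _"] cong: if_cong)

text \<open>
  The minor is nonzero along the segment from the identity to \<open>M\<close>, on which the quadratic form
  stays positive definite, and equals one at the identity.
\<close>

lemma principal_minor_pos: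
  fixes M :: "real ^ 'n ^ 'n"
  assumes pos: "\<And>x. \<exists>i\<in>J. x i \<noteq> 0 \<Longrightarrow> (\<Sum>i\<in>J. \<Sum>j\<in>J. x i * M $ i $ j * x j) > 0"
  shows "principal_minor J M > 0"
proof (rule ccontr)
  assume neg: "\<not> ?thesis"
  define N where "N t = (1 - t) *\<^sub>R mat 1 + t *\<^sub>R M" for t
  have nz: "principal_minor J (N t) \<noteq> 0" if t: "0 \<le> t" "t \<le> 1" for t
  proof (rule principal_minor_nz)
    fix x :: "'n \<Rightarrow> real" assume x: "\<exists>i\<in>J. x i \<noteq> 0"
    have "(\<Sum>i\<in>J. \<Sum>j\<in>J. x i * N t $ i $ j * x j)
        = (1 - t) * (\<Sum>i\<in>J. \<Sum>j\<in>J. x i * (mat 1 :: real ^ 'n ^ 'n) $ i $ j * x j)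
          + t * (\<Sum>i\<in>J. \<Sum>j\<in>J. x i * M $ i $ j * x j)"
      by (simp add: N_def sum_distrib_left sum.distrib[symmetric] algebra_simps)
    also have "(\<Sum>i\<in>J. \<Sum>j\<in>J. x i * (mat 1 :: real ^ 'n ^ 'n) $ i $ j * x j) = (\<Sum>i\<in>J. (x i)\<^sup>2)"
      by (rule sum_mat_1_quadratic)
    finally have eq: "(\<Sum>i\<in>J. \<Sum>j\<in>J. x i * N t $ i $ j * x j)
        = (1 - t) * (\<Sum>i\<in>J. (x i)\<^sup>2) + t * (\<Sum>i\<in>J. \<Sum>j\<in>J. x i * M $ i $ j * x j)" .
    have 1: "(\<Sum>i\<in>J. (x i)\<^sup>2) > 0"
      using x by (auto intro: sum_pos2)
    show "(\<Sum>i\<in>J. \<Sum>j\<in>J. x i * N t $ i $ j * x j) > 0"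
      unfolding eq using t 1 pos[OF x]
      by (cases "t = 0") (auto intro!: add_nonneg_pos mult_nonneg_nonneg mult_pos_pos)
  qed
  have "continuous_on {0..1} (\<lambda>t. principal_minor J (N t))"
    unfolding principal_minor_def N_def by (simp, intro continuous_intros)
  moreover have "N 0 = mat 1" "N 1 = M" by (auto simp: N_def)
  ultimately obtain t where "0 \<le> t" "t \<le> 1" "principal_minor J (N t) = 0"
    using IVT2'[of "\<lambda>t. principal_minor J (N t)" 1 0 0] neg by (auto simp: principal_minor_mat_1)
  with nz show False by blast
qed

section \<open>Hyperbolicity of the minor lift\<close>

theorem theorem2p1:
  fixes p :: "('n::{finite,linorder}, real) mpoly" and k :: nat
  assumes "multiaffine p" and "mpoly_homogeneous k p" and "stable_mpoly p"
  shows "hyperbolic (minor_lift p) (mat 1) \<and>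
         PSD_minors k \<subseteq> hyperbolicity_cone (minor_lift p) (mat 1) \<and>
         PSD_stable (minor_lift p)"
proof -
  note psd = PSD_stable_minor_lift[OF assms(1,3)]
  define e where "e = (\<Sum>J\<in>UNIV. minor_coeff p J)"
  have "e \<noteq> 0"
    using stable_nz_on_positive_orthant[OF assms, of "\<lambda>_. 1"] by (simp add: e_def)
  have sym_entry: "v $ i $ j = v $ j $ i" if "v \<in> sym_matrices" for v :: "((real, 'n) vec, 'n) vec" and i j
    using that by (auto simp: sym_matrices_def transpose_def vec_eq_iff)
  have mat_sym: "(mat 1 :: ((real, 'n) vec, 'n) vec) \<in> sym_matrices"
    by (simp add: sym_matrices_def transpose_mat)
  define L where "L v t = (\<chi> i j. complex_of_real (v $ i $ j) - t * of_real ((mat 1 :: ((real, 'n) vec, 'n) vec) $ i $ j))"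
    for v :: "((real, 'n) vec, 'n) vec" and t
  have roots: "line_roots (minor_lift p) (mat 1) v = {t. matrix_eval (minor_lift p) (L v t) = 0}" for v
    by (simp add: line_roots_def L_def)
  have L_sym: "L v t \<in> sym_matrices" if "v \<in> sym_matrices" for v t
    using sym_entry[OF that] sym_entry[OF mat_sym]
    by (auto simp: L_def sym_matrices_def transpose_def vec_eq_iff)
  \<comment> \<open>A parameter in the lower half plane makes the imaginary part of \<open>L v t\<close> a positive multiple of
    the identity; the upper half plane follows since the coefficients are real.\<close>
  have lower: "matrix_eval (minor_lift p) (L v t) \<noteq> 0" if v: "v \<in> sym_matrices" and t: "Im t < 0" for v t
  proof -
    have "(\<chi> i j. Im (L v t $ i $ j)) = (- Im t) *\<^sub>R mat 1"
      by (simp add: L_def vec_eq_iff)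
    moreover have "pos_def (c *\<^sub>R mat 1 :: ((real, 'n) vec, 'n) vec)" if "c > 0" for c
      using that sym_entry[OF mat_sym] by (simp add: pos_def_def sym_matrices_def transpose_def
          scaleR_matrix_vector_assoc[symmetric] del: vec_eq_iff) (simp add: vec_eq_iff)
    ultimately show ?thesis
      using psd L_sym[OF v] t by (metis PSD_stable_def neg_0_less_iff_less)
  qed
  have conj: "matrix_eval (minor_lift p) (L v (cnj t)) = cnj (matrix_eval (minor_lift p) (L v t))"
    if v: "v \<in> sym_matrices" for v t
  proof -
    have "L v (cnj t) = (\<chi> i j. cnj (L v t $ i $ j))" by (simp add: L_def vec_eq_iff)
    then have "principal_minor J (L v (cnj t)) = cnj (principal_minor J (L v t))" for J
      by (simp add: principal_minor_cnj)
    then show ?thesis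
      by (simp add: matrix_eval_minor_lift L_sym[OF v])
  qed
  have real: "t \<in> \<real>" if v: "v \<in> sym_matrices" and t: "t \<in> line_roots (minor_lift p) (mat 1) v" for v t
  proof -
    have "\<not> Im t < 0" using lower[OF v, of t] t by (auto simp: roots)
    moreover have "\<not> Im (cnj t) < 0" using lower[OF v, of "cnj t"] conj[OF v, of t] t by (auto simp: roots)
    ultimately show ?thesis by (simp add: complex_is_Real_iff)
  qed
  have "hyperbolic (minor_lift p) (mat 1)"
    unfolding hyperbolic_def
    using mpoly_homogeneous_minor_lift[OF assms(2)] mat_sym real \<open>e \<noteq> 0\<close>
    by (auto simp: matrix_eval_minor_lift principal_minor_mat_1 e_def)
  moreover have "v \<in> hyperbolicity_cone (minor_lift p) (mat 1)" if "v \<in> PSD_minors k" for v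
  proof -
    have v: "v \<in> sym_matrices"
      and minors: "\<And>J x. card J = k \<Longrightarrow> (\<Sum>i\<in>J. \<Sum>j\<in>J. x i * v $ i $ j * x j) \<ge> 0"
      using that by (auto simp: PSD_minors_def)
    have "t \<in> \<real>\<^sub>\<ge>\<^sub>0" if t: "t \<in> line_roots (minor_lift p) (mat 1) v" for t
    proof -
      obtain r where r: "t = of_real r" using real[OF v t] by (auto elim: Reals_cases)
      have "r \<ge> 0"
      proof (rule ccontr)
        assume "\<not> r \<ge> 0"
        \<comment> \<open>For a negative root, the minors of size \<open>k\<close> of \<open>v - r I\<close> are all positive and the
          coefficients share the sign of \<open>e\<close>, so the terms of the minor lift cannot cancel.\<close>
        define M where "M = v - r *\<^sub>R mat 1"
        have "principal_minor J M > 0" if J: "card J = k" for J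
        proof (rule principal_minor_pos)
          fix x :: "'n \<Rightarrow> real" assume "\<exists>i\<in>J. x i \<noteq> 0"
          then have "(\<Sum>i\<in>J. (x i)\<^sup>2) > 0" by (auto intro: sum_pos2)
          then have "- r * (\<Sum>i\<in>J. \<Sum>j\<in>J. x i * (mat 1 :: ((real, 'n) vec, 'n) vec) $ i $ j * x j) > 0"
            unfolding sum_mat_1_quadratic using \<open>\<not> r \<ge> 0\<close> by (simp add: mult_neg_pos)
          moreover have "(\<Sum>i\<in>J. \<Sum>j\<in>J. x i * M $ i $ j * x j) = (\<Sum>i\<in>J. \<Sum>j\<in>J. x i * v $ i $ j * x j)
            + - r * (\<Sum>i\<in>J. \<Sum>j\<in>J. x i * (mat 1 :: ((real, 'n) vec, 'n) vec) $ i $ j * x j)"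
            unfolding sum_distrib_left sum.distrib[symmetric] by (simp add: M_def algebra_simps)
          ultimately show "(\<Sum>i\<in>J. \<Sum>j\<in>J. x i * M $ i $ j * x j) > 0"
            using minors[OF J, of x] by simp
        qed
        then have minor_pos: "principal_minor J M > 0" if "minor_coeff p J \<noteq> 0" for J
          using minor_coeff_homogeneous[OF assms(2) that] by blast
        have "\<exists>J. minor_coeff p J \<noteq> 0"
          using \<open>e \<noteq> 0\<close> unfolding e_def by (meson sum.not_neutral_contains_not_neutral)
        then obtain J where J: "minor_coeff p J \<noteq> 0" by blast
        have nonneg: "0 \<le> e * minor_coeff p I" for I
          using stable_coeffs_same_sign[OF assms] by (simp add: e_def)
        have "0 < (\<Sum>I\<in>UNIV. (e * minor_coeff p I) * principal_minor I M)"
        proof (rule sum_pos2[of _ J])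
          show "0 < (e * minor_coeff p J) * principal_minor J M"
            using nonneg[of J] J \<open>e \<noteq> 0\<close> minor_pos[OF J] by (simp add: less_le)
          show "0 \<le> (e * minor_coeff p I) * principal_minor I M" for I
            using nonneg[of I] minor_pos[of I] by (cases "minor_coeff p I = 0") auto
        qed auto
        then have "(\<Sum>I\<in>UNIV. minor_coeff p I * principal_minor I M) \<noteq> 0"
          by (auto simp: mult.assoc sum_distrib_left[symmetric])
        moreover have "L v t = (\<chi> i j. of_real (M $ i $ j))"
          by (simp add: L_def M_def r vec_eq_iff)
        then have "matrix_eval (minor_lift p) (L v t)
            = of_real (\<Sum>I\<in>UNIV. minor_coeff p I * principal_minor I M)"
          using matrix_eval_minor_lift[OF L_sym[OF v, of t], of p] by (simp add: principal_minor_of_real)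
        ultimately show False using t by (simp add: roots del: of_real_sum of_real_mult)
      qed
      then show ?thesis by (simp add: r)
    qed
    then show ?thesis using v by (simp add: hyperbolicity_cone_def)
  qed
  ultimately show ?thesis using psd by blast
qed

end
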